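(* Let $\mathbf{E}$ be a class of morphisms in a category $\mathscr{C}$ such that every morphism in $\mathbf{E}$ is an epimorphism. Let $f$ be a morphism of $\mathscr{C}$ whose canonical $\mathbf{E}$-predecomposition exists. Then: (i) the minimum $\mathbf{E}$-decomposition number $\delta_{\mathbf{E}}(f)$ is defined if and only if the canonical $\mathbf{E}$-decomposition number $\sigma_{\mathbf{E}}(f)$ is defined; (ii) $\delta_{\mathbf{E}}(f)=\sigma_{\mathbf{E}}(f)$ whenever they are defined.
   Context: Sizes: fix universes $\mathcal{U}_1\in\mathcal{U}_2\in\mathcal{U}_3$; small means in $\mathcal{U}_1$, large means in $\mathcal{U}_2$; $\upsilon$ is the smallest ordinal not in $\mathcal{U}_1$. Categories are large by default; classes have no size restriction. Orthogonality: for $p\colon X\to Y$, $e\colon A'\to A$, $m\colon A\to B$, write $p\perp^{e} m$ if for all $u\colon X\to A'$, $v\colon Y\to B$ with $m e u=v p$ there is a unique $h\colon Y\to A$ with $hp=eu$ and $mh=v$. Write $p\perp m$ for $p\perp^{\mathrm{id}_A}m$. For a class $\mathbf{E}$, $\mathbf{E}\perp^{e}m$ (resp. $\mathbf{E}\perp m$) means $p\perp^e m$ (resp. $p\perp m$) for all $p\in\mathbf{E}$. Decompositions: an ordinal $\alpha$ is regarded as the poset $\{\beta\mid\beta<\alpha\}$. For a functor $A_\bullet\colon\alpha\to\mathscr{C}$, $A_{\beta,\beta'}\colon A_\beta\to A_{\beta'}$ is the image of the unique morphism $\beta\le\beta'$. A transfinite $\alpha$-sequence is a functor $A_\bullet\colon\alpha\to\mathscr{C}$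 with $A_\gamma\cong\mathrm{colim}_{\beta<\gamma}A_\beta$ (canonically) for every non-zero limit ordinal $\gamma<\alpha$; it is an $\mathbf{E}$-transfinite sequence if $A_{\beta,\beta+1}\in\mathbf{E}$ whenever $\beta+1<\alpha$. For $0<\gamma\le\upsilon$, an $(\mathbf{E},\gamma)$-predecomposition $(A_\bullet,f_\bullet,X)$ is an $\mathbf{E}$-transfinite $\gamma$-sequence $A_\bullet$ with a cocone $(f_\alpha\colon A_\alpha\to X)_{\alpha<\gamma}$ over it; it is a predecomposition of the morphism $f_0$. It stabilizes at $\alpha<\gamma$ if $\mathbf{E}\perp f_\beta$ for all $\beta$ with $\alpha\le\beta<\gamma$. It is a decomposition if it stabilizes at some $\alpha<\gamma$, and the least such $\alpha$ is its length $|f_\bullet|$. When $\gamma=\upsilon$ one says $\mathbf{E}$-predecomposition and $\mathbf{E}$-decomposition. An $(\mathbf{E},\gamma)$-predecomposition is canonical if $\mathbf{E}\perp^{A_{\alpha,\alpha+1}}f_{\alpha+1}$ for every $\alpha$ with $\alpha+1<\gamma$; the canonical predecomposition of a morphism is unique up to isomorphism if it exists. $\delta_{\mathbf{E}}(f)$ is the smallest ordinal $\alpha$ such that $f$ has an $\mathbf{E}$-decomposition of length $\alpha$ (undefined if $f$ has no $\mathbf{E}$-decomposition). $\sigma_{\mathbf{E}}(f)$ is the length of the canonical $\mathbf{E}$-predecomposition of $f$ if that exists and stabilizes (otherwise undefined). *)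

theory Defs
  imports "HOL-Library.Equipollence"
begin

section \<open>Ordinals below \<open>\<upsilon>\<close>\<close>

text \<open>
  The ordinals smaller than \<open>\<upsilon>\<close>, the smallest ordinal outside the universe of small sets, are the
  elements of a well-ordered type \<open>'o\<close>.  The smallest ordinal outside a Grothendieck universe is
  an infinite, regular, strong limit cardinal, and every such cardinal arises in this way; the
  predicate below says that \<open>\<upsilon>\<close>, the order type of \<open>'o\<close>, is one.  The strong limit clause
  implies that proper initial segments of \<open>'o\<close> have smaller cardinality than \<open>'o\<close>, so that
  \<open>\<upsilon>\<close> is an initial ordinal.  Uncountability is not demanded, which admits the universe of
  hereditarily finite sets as well.
\<close>

definition universe_ordinals :: "'o::wellorder itself \<Rightarrow> bool" where
  "universe_ordinals _ \<longleftrightarrow>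
     infinite (UNIV :: 'o set) \<and>
     (\<forall>\<alpha>::'o. Pow {..<\<alpha>} \<prec> (UNIV :: 'o set)) \<and>
     (\<forall>(\<alpha>::'o) (s::'o \<Rightarrow> 'o). \<exists>\<beta>. \<forall>\<xi><\<alpha>. s \<xi> < \<beta>)"

text \<open>
  An ordinal \<open>\<gamma> \<le> \<upsilon>\<close> is identified with the poset of smaller ordinals, that is, with
  a downward closed set of elements of \<open>'o\<close>; in particular \<open>\<upsilon>\<close> itself is \<open>UNIV\<close>.
\<close>

definition ordinal :: "'o::wellorder set \<Rightarrow> bool" where
  "ordinal \<gamma> \<longleftrightarrow> (\<forall>\<beta>\<in>\<gamma>. \<forall>\<alpha><\<beta>. \<alpha> \<in> \<gamma>)"

definition ord_zero :: "'o::wellorder" where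
  "ord_zero = (LEAST \<alpha>. True)"

text \<open>\<open>is_succ \<alpha> \<alpha>'\<close> means \<open>\<alpha>' = \<alpha> + 1\<close>.\<close>

definition is_succ :: "'o::wellorder \<Rightarrow> 'o \<Rightarrow> bool" where
  "is_succ \<alpha> \<alpha>' \<longleftrightarrow> \<alpha> < \<alpha>' \<and> (\<forall>\<beta>>\<alpha>. \<alpha>' \<le> \<beta>)"

definition nonzero_limit :: "'o::wellorder \<Rightarrow> bool" where
  "nonzero_limit \<alpha> \<longleftrightarrow> \<alpha> \<noteq> ord_zero \<and> (\<nexists>\<beta>. is_succ \<beta> \<alpha>)"


section \<open>Categories\<close>

record ('ob, 'mor) category =
  Ob :: "'ob set"
  Mor :: "'mor set"
  Dom :: "'mor \<Rightarrow> 'ob"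
  Cod :: "'mor \<Rightarrow> 'ob"
  Id :: "'ob \<Rightarrow> 'mor"
  Comp :: "'mor \<Rightarrow> 'mor \<Rightarrow> 'mor" (infixl "\<odot>\<index>" 70)

definition hom :: "('ob, 'mor) category \<Rightarrow> 'ob \<Rightarrow> 'ob \<Rightarrow> 'mor set" where
  "hom C X Y = {f \<in> Mor C. Dom C f = X \<and> Cod C f = Y}"

text \<open>\<open>g \<odot> f\<close> is the composite ``\<open>f\<close> first, then \<open>g\<close>''.\<close>

locale category =
  fixes C :: "('ob, 'mor) category" (structure)
  assumes dom_in_Ob: "f \<in> Mor C \<Longrightarrow> Dom C f \<in> Ob C"
    and cod_in_Ob: "f \<in> Mor C \<Longrightarrow> Cod C f \<in> Ob C"
    and id_in_hom: "X \<in> Ob C \<Longrightarrow> Id C X \<in> hom C X X"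
    and comp_in_hom: "f \<in> hom C X Y \<Longrightarrow> g \<in> hom C Y Z \<Longrightarrow> g \<odot> f \<in> hom C X Z"
    and comp_id_left: "f \<in> hom C X Y \<Longrightarrow> Id C Y \<odot> f = f"
    and comp_id_right: "f \<in> hom C X Y \<Longrightarrow> f \<odot> Id C X = f"
    and comp_assoc: "f \<in> hom C W X \<Longrightarrow> g \<in> hom C X Y \<Longrightarrow> h \<in> hom C Y Z \<Longrightarrow>
                       h \<odot> g \<odot> f = h \<odot> (g \<odot> f)"

definition epimorphism :: "('ob, 'mor) category \<Rightarrow> 'mor \<Rightarrow> bool" where
  "epimorphism C p \<longleftrightarrow> p \<in> Mor C \<and>
     (\<forall>Z. \<forall>g \<in> hom C (Cod C p) Z. \<forall>h \<in> hom C (Cod C p) Z.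
        g \<odot>\<^bsub>C\<^esub> p = h \<odot>\<^bsub>C\<^esub> p \<longrightarrow> g = h)"


section \<open>Orthogonality\<close>

text \<open>\<open>orthogonal_along C p e m\<close> is \<open>p \<perp>\<^sup>e m\<close>; it is meant for morphisms with \<open>Cod C e = Dom C m\<close>.\<close>

definition orthogonal_along :: "('ob, 'mor) category \<Rightarrow> 'mor \<Rightarrow> 'mor \<Rightarrow> 'mor \<Rightarrow> bool" where
  "orthogonal_along C p e m \<longleftrightarrow>
     (\<forall>u \<in> hom C (Dom C p) (Dom C e). \<forall>v \<in> hom C (Cod C p) (Cod C m).
        m \<odot>\<^bsub>C\<^esub> e \<odot>\<^bsub>C\<^esub> u = v \<odot>\<^bsub>C\<^esub> p \<longrightarrow>
        (\<exists>!h. h \<in> hom C (Cod C p) (Cod C e) \<and>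
              h \<odot>\<^bsub>C\<^esub> p = e \<odot>\<^bsub>C\<^esub> u \<and> m \<odot>\<^bsub>C\<^esub> h = v))"

definition orthogonal :: "('ob, 'mor) category \<Rightarrow> 'mor \<Rightarrow> 'mor \<Rightarrow> bool" where
  "orthogonal C p m \<longleftrightarrow> orthogonal_along C p (Id C (Dom C m)) m"


section \<open>Transfinite sequences\<close>

text \<open>
  A functor \<open>A\<close> from the poset \<open>\<gamma>\<close> to \<open>C\<close> is given by its object part \<open>A \<beta>\<close> and its morphism
  part \<open>a \<beta> \<beta>'\<close>, the image of \<open>\<beta> \<le> \<beta>'\<close>; values outside \<open>\<gamma>\<close> are irrelevant.
\<close>

definition poset_functor ::
  "('ob, 'mor) category \<Rightarrow> 'o::wellorder set \<Rightarrow> ('o \<Rightarrow> 'ob) \<Rightarrow> ('o \<Rightarrow> 'o \<Rightarrow> 'mor) \<Rightarrow> bool" where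
  "poset_functor C \<gamma> A a \<longleftrightarrow>
     (\<forall>\<beta>\<in>\<gamma>. A \<beta> \<in> Ob C) \<and>
     (\<forall>\<beta>\<in>\<gamma>. \<forall>\<beta>'\<in>\<gamma>. \<beta> \<le> \<beta>' \<longrightarrow> a \<beta> \<beta>' \<in> hom C (A \<beta>) (A \<beta>')) \<and>
     (\<forall>\<beta>\<in>\<gamma>. a \<beta> \<beta> = Id C (A \<beta>)) \<and>
     (\<forall>\<beta>\<in>\<gamma>. \<forall>\<beta>'\<in>\<gamma>. \<forall>\<beta>''\<in>\<gamma>. \<beta> \<le> \<beta>' \<longrightarrow> \<beta>' \<le> \<beta>'' \<longrightarrow>
        a \<beta>' \<beta>'' \<odot>\<^bsub>C\<^esub> a \<beta> \<beta>' = a \<beta> \<beta>'')"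

definition cocone ::
  "('ob, 'mor) category \<Rightarrow> 'o::wellorder set \<Rightarrow> ('o \<Rightarrow> 'ob) \<Rightarrow> ('o \<Rightarrow> 'o \<Rightarrow> 'mor) \<Rightarrow>
   'ob \<Rightarrow> ('o \<Rightarrow> 'mor) \<Rightarrow> bool" where
  "cocone C \<gamma> A a X f \<longleftrightarrow>
     X \<in> Ob C \<and>
     (\<forall>\<beta>\<in>\<gamma>. f \<beta> \<in> hom C (A \<beta>) X) \<and>
     (\<forall>\<beta>\<in>\<gamma>. \<forall>\<beta>'\<in>\<gamma>. \<beta> \<le> \<beta>' \<longrightarrow> f \<beta>' \<odot>\<^bsub>C\<^esub> a \<beta> \<beta>' = f \<beta>)"

definition colimit_cocone ::
  "('ob, 'mor) category \<Rightarrow> 'o::wellorder set \<Rightarrow> ('o \<Rightarrow> 'ob) \<Rightarrow> ('o \<Rightarrow> 'o \<Rightarrow> 'mor) \<Rightarrow>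
   'ob \<Rightarrow> ('o \<Rightarrow> 'mor) \<Rightarrow> bool" where
  "colimit_cocone C \<gamma> A a X f \<longleftrightarrow>
     cocone C \<gamma> A a X f \<and>
     (\<forall>Y g. cocone C \<gamma> A a Y g \<longrightarrow>
        (\<exists>!h. h \<in> hom C X Y \<and> (\<forall>\<beta>\<in>\<gamma>. h \<odot>\<^bsub>C\<^esub> f \<beta> = g \<beta>)))"

definition transfinite_sequence ::
  "('ob, 'mor) category \<Rightarrow> 'o::wellorder set \<Rightarrow> ('o \<Rightarrow> 'ob) \<Rightarrow> ('o \<Rightarrow> 'o \<Rightarrow> 'mor) \<Rightarrow> bool" where
  "transfinite_sequence C \<gamma> A a \<longleftrightarrow>
     poset_functor C \<gamma> A a \<and>
     (\<forall>\<mu>\<in>\<gamma>. nonzero_limit \<mu> \<longrightarrow> colimit_cocone C {..<\<mu>} A a (A \<mu>) (\<lambda>\<beta>. a \<beta> \<mu>))"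

definition E_transfinite_sequence ::
  "('ob, 'mor) category \<Rightarrow> 'mor set \<Rightarrow> 'o::wellorder set \<Rightarrow>
   ('o \<Rightarrow> 'ob) \<Rightarrow> ('o \<Rightarrow> 'o \<Rightarrow> 'mor) \<Rightarrow> bool" where
  "E_transfinite_sequence C E \<gamma> A a \<longleftrightarrow>
     transfinite_sequence C \<gamma> A a \<and>
     (\<forall>\<beta>\<in>\<gamma>. \<forall>\<beta>'\<in>\<gamma>. is_succ \<beta> \<beta>' \<longrightarrow> a \<beta> \<beta>' \<in> E)"


section \<open>Decompositions\<close>

record ('o, 'ob, 'mor) decomposition_data =
  Stage :: "'o \<Rightarrow> 'ob"
  Trans :: "'o \<Rightarrow> 'o \<Rightarrow> 'mor"
  Leg :: "'o \<Rightarrow> 'mor"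
  Apex :: "'ob"

definition predecomposition ::
  "('ob, 'mor) category \<Rightarrow> 'mor set \<Rightarrow> 'o::wellorder set \<Rightarrow>
   ('o, 'ob, 'mor) decomposition_data \<Rightarrow> bool" where
  "predecomposition C E \<gamma> D \<longleftrightarrow>
     ordinal \<gamma> \<and> \<gamma> \<noteq> {} \<and>
     E_transfinite_sequence C E \<gamma> (Stage D) (Trans D) \<and>
     cocone C \<gamma> (Stage D) (Trans D) (Apex D) (Leg D)"

definition is_of :: "('o::wellorder, 'ob, 'mor) decomposition_data \<Rightarrow> 'mor \<Rightarrow> bool" where
  "is_of D f \<longleftrightarrow> Leg D ord_zero = f"

definition stabilizes_at ::
  "('ob, 'mor) category \<Rightarrow> 'mor set \<Rightarrow> 'o::wellorder set \<Rightarrow>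
   ('o, 'ob, 'mor) decomposition_data \<Rightarrow> 'o \<Rightarrow> bool" where
  "stabilizes_at C E \<gamma> D \<alpha> \<longleftrightarrow>
     \<alpha> \<in> \<gamma> \<and> (\<forall>\<beta>\<in>\<gamma>. \<alpha> \<le> \<beta> \<longrightarrow> (\<forall>p\<in>E. orthogonal C p (Leg D \<beta>)))"

definition decomposition ::
  "('ob, 'mor) category \<Rightarrow> 'mor set \<Rightarrow> 'o::wellorder set \<Rightarrow>
   ('o, 'ob, 'mor) decomposition_data \<Rightarrow> bool" where
  "decomposition C E \<gamma> D \<longleftrightarrow>
     predecomposition C E \<gamma> D \<and> (\<exists>\<alpha>. stabilizes_at C E \<gamma> D \<alpha>)"

text \<open>Meaningful for decompositions only.\<close>

definition decomposition_length ::
  "('ob, 'mor) category \<Rightarrow> 'mor set \<Rightarrow> 'o::wellorder set \<Rightarrow>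
   ('o, 'ob, 'mor) decomposition_data \<Rightarrow> 'o" where
  "decomposition_length C E \<gamma> D = (LEAST \<alpha>. stabilizes_at C E \<gamma> D \<alpha>)"

definition canonical_predecomposition ::
  "('ob, 'mor) category \<Rightarrow> 'mor set \<Rightarrow> 'o::wellorder set \<Rightarrow>
   ('o, 'ob, 'mor) decomposition_data \<Rightarrow> bool" where
  "canonical_predecomposition C E \<gamma> D \<longleftrightarrow>
     predecomposition C E \<gamma> D \<and>
     (\<forall>\<alpha>\<in>\<gamma>. \<forall>\<alpha>'\<in>\<gamma>. is_succ \<alpha> \<alpha>' \<longrightarrow>
        (\<forall>p\<in>E. orthogonal_along C p (Trans D \<alpha> \<alpha>') (Leg D \<alpha>')))"


section \<open>Decomposition numbers\<close>

text \<open>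
  Both numbers are ordinals below \<open>\<upsilon>\<close>; \<open>None\<close> stands for ``undefined''.
  Since canonical predecompositions of \<open>f\<close> are unique up to isomorphism, their length does not depend
  on the choice of one, and the description operator picks that common value.
\<close>

definition min_decomposition_number ::
  "('ob, 'mor) category \<Rightarrow> 'mor set \<Rightarrow> 'mor \<Rightarrow> 'o::wellorder option" (\<open>\<delta>\<close>) where
  "\<delta> C E f =
     (if \<exists>D :: ('o, 'ob, 'mor) decomposition_data. decomposition C E UNIV D \<and> is_of D f
      then Some (LEAST \<alpha>. \<exists>D :: ('o, 'ob, 'mor) decomposition_data.
                   decomposition C E UNIV D \<and> is_of D f \<and> decomposition_length C E UNIV D = \<alpha>)
      else None)"

definition canonical_decomposition_number ::
  "('ob, 'mor) category \<Rightarrow> 'mor set \<Rightarrow> 'mor \<Rightarrow> 'o::wellorder option" (\<open>\<sigma>\<close>) where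
  "\<sigma> C E f =
     (if \<exists>D :: ('o, 'ob, 'mor) decomposition_data.
           canonical_predecomposition C E UNIV D \<and> is_of D f \<and> decomposition C E UNIV D
      then Some (THE \<alpha>. \<exists>D :: ('o, 'ob, 'mor) decomposition_data.
                   canonical_predecomposition C E UNIV D \<and> is_of D f \<and>
                   decomposition C E UNIV D \<and> decomposition_length C E UNIV D = \<alpha>)
      else None)"

end

theory Submission
  imports Defs
begin

text \<open>
  The composites \<open>A\<^sub>0 \<rightarrow> A\<^sub>\<alpha>\<close> along an \<open>E\<close>-transfinite sequence are epimorphisms, since
  epimorphisms are closed under transfinite composition (\<open>epimorphism_from_first_stage\<close>).
  A morphism out of \<open>A\<^sub>\<alpha>\<close> is therefore determined by its restriction to \<open>A\<^sub>0\<close>, so that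
  a transfinite construction of compatible morphisms out of a sequence needs no record of coherence:
  it is enough to know, stage by stage, that a morphism with the right restriction exists
  (\<open>comparison_morphism\<close>).

  Compare a canonical predecomposition \<open>(B, b, g)\<close> of a morphism with any predecomposition
  \<open>(A, a, f)\<close> of the same morphism in this way.  The canonical orthogonality condition yields
  morphisms \<open>t : A\<^sub>\<alpha> \<rightarrow> B\<^sub>\<alpha>\<close> under \<open>A\<^sub>0 = B\<^sub>0\<close>.  Conversely, if \<open>E \<perp> f\<^sub>\<alpha>\<close>,
  then the transfinite composite \<open>B\<^sub>0 \<rightarrow> B\<^sub>\<alpha>\<close> lifts against \<open>f\<^sub>\<alpha>\<close>, which yields a
  morphism \<open>h : B\<^sub>\<alpha> \<rightarrow> A\<^sub>\<alpha>\<close>; this is the same comparison, now with the constant sequence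
  \<open>A\<^sub>\<alpha>\<close> as its target.  Because \<open>B\<^sub>0 \<rightarrow> B\<^sub>\<alpha>\<close> is an epimorphism, \<open>t h\<close> is the
  identity.  So \<open>g\<^sub>\<alpha>\<close> is a retract of \<open>f\<^sub>\<alpha>\<close> over their common codomain and inherits
  \<open>E \<perp> g\<^sub>\<alpha>\<close> (\<open>orthogonal_retract\<close>, \<open>canonical_leg_orthogonal\<close>).

  Thus the canonical predecomposition stabilizes wherever some predecomposition of the
  same morphism does
  (\<open>canonical_stabilizes_first\<close>).  It is itself one of the competitors in the minimum that defines
  \<open>\<delta>\<close>, so both numbers are defined together and agree.
\<close>

section \<open>Induction on ordinals\<close>

lemma ord_zero_le: "ord_zero \<le> (\<alpha>::'o::wellorder)"
  unfolding ord_zero_def by (rule Least_le) simp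

lemma ordinal_downward: "ordinal \<gamma> \<Longrightarrow> \<beta> \<in> \<gamma> \<Longrightarrow> \<alpha> \<le> \<beta> \<Longrightarrow> \<alpha> \<in> \<gamma>"
  unfolding ordinal_def by (metis order_le_less)

lemma ordinal_induct [consumes 2, case_names zero succ limit]:
  fixes \<gamma> :: "'o::wellorder set"
  assumes "ordinal \<gamma>" and "\<alpha> \<in> \<gamma>"
    and zero: "ord_zero \<in> \<gamma> \<Longrightarrow> P ord_zero"
    and succ: "\<And>\<beta> \<alpha>. \<beta> \<in> \<gamma> \<Longrightarrow> \<alpha> \<in> \<gamma> \<Longrightarrow> is_succ \<beta> \<alpha> \<Longrightarrow> \<beta> \<le> \<alpha> \<Longrightarrow> P \<beta> \<Longrightarrow> P \<alpha>"
    and limit: "\<And>\<mu>. \<mu> \<in> \<gamma> \<Longrightarrow> nonzero_limit \<mu> \<Longrightarrow> ord_zero < \<mu> \<Longrightarrow>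
                  (\<And>\<beta>. \<beta> < \<mu> \<Longrightarrow> \<beta> \<in> \<gamma> \<and> P \<beta>) \<Longrightarrow> P \<mu>"
  shows "P \<alpha>"
  using \<open>\<alpha> \<in> \<gamma>\<close>
proof (induction \<alpha> rule: less_induct)
  case (less \<alpha>)
  have below: "\<beta> \<in> \<gamma> \<and> P \<beta>" if "\<beta> < \<alpha>" for \<beta>
    using that less ordinal_downward[OF \<open>ordinal \<gamma>\<close>] by (meson less_imp_le)
  consider "\<alpha> = ord_zero" | \<beta> where "is_succ \<beta> \<alpha>" | "nonzero_limit \<alpha>"
    unfolding nonzero_limit_def by blast
  then show ?case
  proof cases
    case 1
    then show ?thesis using zero less.prems by simp
  next
    case 2
    then have "\<beta> < \<alpha>" by (simp add: is_succ_def)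
    then show ?thesis using succ[of \<beta> \<alpha>] 2 below less.prems by simp
  next
    case 3
    then have "ord_zero < \<alpha>"
      using ord_zero_le[of \<alpha>] unfolding nonzero_limit_def by (metis order_le_less)
    then show ?thesis using limit[of \<alpha>] 3 below less.prems by simp
  qed
qed

section \<open>Epimorphisms, cocones and lifting\<close>

lemma in_hom_Mor: "f \<in> hom C X Y \<Longrightarrow> f \<in> Mor C \<and> Dom C f = X \<and> Cod C f = Y"
  by (simp add: hom_def)

lemma epimorphism_cancel:
  assumes "epimorphism C p" and "p \<in> hom C X Y"
    and "g \<in> hom C Y Z" and "h \<in> hom C Y Z" and "g \<odot>\<^bsub>C\<^esub> p = h \<odot>\<^bsub>C\<^esub> p"
  shows "g = h"
  using assms unfolding epimorphism_def hom_def by blast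

lemma epimorphismI:
  assumes "p \<in> hom C X Y"
    and "\<And>Z g h. g \<in> hom C Y Z \<Longrightarrow> h \<in> hom C Y Z \<Longrightarrow> g \<odot>\<^bsub>C\<^esub> p = h \<odot>\<^bsub>C\<^esub> p \<Longrightarrow> g = h"
  shows "epimorphism C p"
  using assms unfolding epimorphism_def hom_def by blast

lemma poset_functorD:
  assumes "poset_functor C \<gamma> A a"
  shows "\<beta> \<in> \<gamma> \<Longrightarrow> A \<beta> \<in> Ob C"
    and "\<beta> \<in> \<gamma> \<Longrightarrow> \<beta>' \<in> \<gamma> \<Longrightarrow> \<beta> \<le> \<beta>' \<Longrightarrow> a \<beta> \<beta>' \<in> hom C (A \<beta>) (A \<beta>')"
    and "\<beta> \<in> \<gamma> \<Longrightarrow> a \<beta> \<beta> = Id C (A \<beta>)"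
    and "\<beta> \<in> \<gamma> \<Longrightarrow> \<beta>' \<in> \<gamma> \<Longrightarrow> \<beta>'' \<in> \<gamma> \<Longrightarrow> \<beta> \<le> \<beta>' \<Longrightarrow> \<beta>' \<le> \<beta>'' \<Longrightarrow>
           a \<beta>' \<beta>'' \<odot>\<^bsub>C\<^esub> a \<beta> \<beta>' = a \<beta> \<beta>''"
  using assms unfolding poset_functor_def by simp_all

lemma coconeD:
  assumes "cocone C \<gamma> A a X f"
  shows "X \<in> Ob C"
    and "\<beta> \<in> \<gamma> \<Longrightarrow> f \<beta> \<in> hom C (A \<beta>) X"
    and "\<beta> \<in> \<gamma> \<Longrightarrow> \<beta>' \<in> \<gamma> \<Longrightarrow> \<beta> \<le> \<beta>' \<Longrightarrow> f \<beta>' \<odot>\<^bsub>C\<^esub> a \<beta> \<beta>' = f \<beta>"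
  using assms unfolding cocone_def by simp_all

lemma colimit_cocone_factor:
  assumes "colimit_cocone C \<gamma> A a X f" and "cocone C \<gamma> A a Y g"
  obtains h where "h \<in> hom C X Y" and "\<And>\<beta>. \<beta> \<in> \<gamma> \<Longrightarrow> h \<odot>\<^bsub>C\<^esub> f \<beta> = g \<beta>"
  using assms unfolding colimit_cocone_def by metis

lemma E_transfinite_sequenceD:
  assumes "E_transfinite_sequence C E \<gamma> A a"
  shows "poset_functor C \<gamma> A a"
    and "\<mu> \<in> \<gamma> \<Longrightarrow> nonzero_limit \<mu> \<Longrightarrow> colimit_cocone C {..<\<mu>} A a (A \<mu>) (\<lambda>\<beta>. a \<beta> \<mu>)"
    and "\<beta> \<in> \<gamma> \<Longrightarrow> \<beta>' \<in> \<gamma> \<Longrightarrow> is_succ \<beta> \<beta>' \<Longrightarrow> a \<beta> \<beta>' \<in> E"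
  using assms unfolding E_transfinite_sequence_def transfinite_sequence_def by simp_all

lemma predecompositionD:
  assumes "predecomposition C E \<gamma> D"
  shows "ordinal \<gamma>"
    and "E_transfinite_sequence C E \<gamma> (Stage D) (Trans D)"
    and "cocone C \<gamma> (Stage D) (Trans D) (Apex D) (Leg D)"
  using assms unfolding predecomposition_def by simp_all

lemma orthogonal_alongE:
  assumes "orthogonal_along C p e m"
    and "p \<in> hom C W P" and "e \<in> hom C A' A" and "m \<in> hom C A B"
    and "u \<in> hom C W A'" and "v \<in> hom C P B"
    and "m \<odot>\<^bsub>C\<^esub> e \<odot>\<^bsub>C\<^esub> u = v \<odot>\<^bsub>C\<^esub> p"
  obtains h where "h \<in> hom C P A" and "h \<odot>\<^bsub>C\<^esub> p = e \<odot>\<^bsub>C\<^esub> u" and "m \<odot>\<^bsub>C\<^esub> h = v"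
    and "\<And>k. k \<in> hom C P A \<Longrightarrow> k \<odot>\<^bsub>C\<^esub> p = e \<odot>\<^bsub>C\<^esub> u \<Longrightarrow> m \<odot>\<^bsub>C\<^esub> k = v \<Longrightarrow> k = h"
proof -
  have "\<exists>!h. h \<in> hom C P A \<and> h \<odot>\<^bsub>C\<^esub> p = e \<odot>\<^bsub>C\<^esub> u \<and> m \<odot>\<^bsub>C\<^esub> h = v"
    using assms unfolding orthogonal_along_def
    by (simp add: in_hom_Mor[OF assms(2)] in_hom_Mor[OF assms(3)] in_hom_Mor[OF assms(4)])
  then show ?thesis using that by blast
qed

lemma is_of_dom_cod:
  assumes "predecomposition C E \<gamma> D" and "is_of D f"
  shows "Stage D ord_zero = Dom C f" and "Apex D = Cod C f"
proof -
  obtain \<alpha> where "\<alpha> \<in> \<gamma>" using assms(1) unfolding predecomposition_def by blast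
  then have "ord_zero \<in> \<gamma>"
    using ordinal_downward[OF predecompositionD(1)[OF assms(1)]] ord_zero_le by blast
  then have "f \<in> hom C (Stage D ord_zero) (Apex D)"
    using coconeD(2)[OF predecompositionD(3)[OF assms(1)]] assms(2) by (metis is_of_def)
  then show "Stage D ord_zero = Dom C f" and "Apex D = Cod C f"
    by (simp_all add: hom_def)
qed

context category
begin

lemma cocone_postcompose:
  assumes "cocone C \<gamma> A a X f" and "g \<in> hom C X Y"
    and a: "\<And>\<beta> \<beta>'. \<beta> \<in> \<gamma> \<Longrightarrow> \<beta>' \<in> \<gamma> \<Longrightarrow> \<beta> \<le> \<beta>' \<Longrightarrow> a \<beta> \<beta>' \<in> hom C (A \<beta>) (A \<beta>')"
  shows "cocone C \<gamma> A a Y (\<lambda>\<beta>. g \<odot> f \<beta>)"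
  unfolding cocone_def
proof (intro conjI ballI impI)
  show "Y \<in> Ob C" using assms(2) cod_in_Ob by (auto simp: hom_def)
next
  fix \<beta> assume "\<beta> \<in> \<gamma>"
  then show "g \<odot> f \<beta> \<in> hom C (A \<beta>) Y"
    using coconeD(2)[OF assms(1)] assms(2) comp_in_hom by blast
next
  fix \<beta> \<beta>' assume h: "\<beta> \<in> \<gamma>" "\<beta>' \<in> \<gamma>" "\<beta> \<le> \<beta>'"
  show "g \<odot> f \<beta>' \<odot> a \<beta> \<beta>' = g \<odot> f \<beta>"
    using comp_assoc[OF a[OF h] coconeD(2)[OF assms(1) h(2)] assms(2)]
      coconeD(3)[OF assms(1) h] by simp
qed

section \<open>Morphisms out of an \<open>E\<close>-transfinite sequence\<close>

text \<open>
  At a limit stage, two morphisms that agree on \<open>A\<^sub>0\<close> agree on all earlier stages by the induction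
  hypothesis, hence are induced by the same cocone.
\<close>

lemma epimorphism_from_first_stage:
  assumes "ordinal \<gamma>" and seq: "E_transfinite_sequence C E \<gamma> A a"
    and epi: "\<And>p. p \<in> E \<Longrightarrow> epimorphism C p" and "\<alpha> \<in> \<gamma>"
  shows "epimorphism C (a ord_zero \<alpha>)"
  using \<open>ordinal \<gamma>\<close> \<open>\<alpha> \<in> \<gamma>\<close>
proof (induction rule: ordinal_induct)
  case zero
  note F = poset_functorD[OF E_transfinite_sequenceD(1)[OF seq]]
  have "a ord_zero ord_zero = Id C (A ord_zero)" and "A ord_zero \<in> Ob C"
    using F zero by blast+
  then show ?case
    using epimorphismI[OF id_in_hom] comp_id_right by metis
next
  case (succ \<beta> \<alpha>)
  note F = poset_functorD[OF E_transfinite_sequenceD(1)[OF seq]]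
  have z: "ord_zero \<in> \<gamma>"
    using ordinal_downward[OF \<open>ordinal \<gamma>\<close> \<open>\<alpha> \<in> \<gamma>\<close>] ord_zero_le by blast
  have a0: "a ord_zero \<beta> \<in> hom C (A ord_zero) (A \<beta>)"
    and a1: "a \<beta> \<alpha> \<in> hom C (A \<beta>) (A \<alpha>)"
    and eq: "a \<beta> \<alpha> \<odot> a ord_zero \<beta> = a ord_zero \<alpha>"
    using F(2)[OF z \<open>\<beta> \<in> \<gamma>\<close> ord_zero_le] F(2)[OF \<open>\<beta> \<in> \<gamma>\<close> \<open>\<alpha> \<in> \<gamma>\<close> \<open>\<beta> \<le> \<alpha>\<close>]
      F(4)[OF z \<open>\<beta> \<in> \<gamma>\<close> \<open>\<alpha> \<in> \<gamma>\<close> ord_zero_le \<open>\<beta> \<le> \<alpha>\<close>] by blast+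
  have step: "epimorphism C (a \<beta> \<alpha>)"
    using epi E_transfinite_sequenceD(3)[OF seq] succ by blast
  show ?case
  proof (rule epimorphismI[OF F(2)[OF z \<open>\<alpha> \<in> \<gamma>\<close> ord_zero_le]])
    fix Z g h
    assume g: "g \<in> hom C (A \<alpha>) Z" and h: "h \<in> hom C (A \<alpha>) Z"
      and "g \<odot> a ord_zero \<alpha> = h \<odot> a ord_zero \<alpha>"
    then have "g \<odot> a \<beta> \<alpha> \<odot> a ord_zero \<beta> = h \<odot> a \<beta> \<alpha> \<odot> a ord_zero \<beta>"
      using comp_assoc[OF a0 a1 g] comp_assoc[OF a0 a1 h] eq by simp
    then have "g \<odot> a \<beta> \<alpha> = h \<odot> a \<beta> \<alpha>"
      using epimorphism_cancel[OF succ.IH a0 comp_in_hom[OF a1 g] comp_in_hom[OF a1 h]] by simp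
    then show "g = h"
      using epimorphism_cancel[OF step a1 g h] by simp
  qed
next
  case (limit \<mu>)
  note F = poset_functorD[OF E_transfinite_sequenceD(1)[OF seq]]
  have z: "ord_zero \<in> \<gamma>"
    using ordinal_downward[OF \<open>ordinal \<gamma>\<close> \<open>\<mu> \<in> \<gamma>\<close>] ord_zero_le by blast
  have colim: "colimit_cocone C {..<\<mu>} A a (A \<mu>) (\<lambda>\<beta>. a \<beta> \<mu>)"
    using E_transfinite_sequenceD(2)[OF seq] limit by blast
  show ?case
  proof (rule epimorphismI[OF F(2)[OF z \<open>\<mu> \<in> \<gamma>\<close> ord_zero_le]])
    fix Z g h
    assume g: "g \<in> hom C (A \<mu>) Z" and h: "h \<in> hom C (A \<mu>) Z"
      and eq: "g \<odot> a ord_zero \<mu> = h \<odot> a ord_zero \<mu>"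
    have agree: "g \<odot> a \<beta> \<mu> = h \<odot> a \<beta> \<mu>" if "\<beta> < \<mu>" for \<beta>
    proof -
      have b: "\<beta> \<in> \<gamma>" and IH: "epimorphism C (a ord_zero \<beta>)" and le: "\<beta> \<le> \<mu>"
        using limit.IH[OF that] that by auto
      have a0: "a ord_zero \<beta> \<in> hom C (A ord_zero) (A \<beta>)"
        and a1: "a \<beta> \<mu> \<in> hom C (A \<beta>) (A \<mu>)"
        and c: "a \<beta> \<mu> \<odot> a ord_zero \<beta> = a ord_zero \<mu>"
        using F(2)[OF z b ord_zero_le] F(2)[OF b \<open>\<mu> \<in> \<gamma>\<close> le]
          F(4)[OF z b \<open>\<mu> \<in> \<gamma>\<close> ord_zero_le le] by blast+
      have "g \<odot> a \<beta> \<mu> \<odot> a ord_zero \<beta> = h \<odot> a \<beta> \<mu> \<odot> a ord_zero \<beta>"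
        using comp_assoc[OF a0 a1 g] comp_assoc[OF a0 a1 h] c eq by simp
      then show ?thesis
        using epimorphism_cancel[OF IH a0 comp_in_hom[OF a1 g] comp_in_hom[OF a1 h]] by simp
    qed
    have "cocone C {..<\<mu>} A a (A \<mu>) (\<lambda>\<beta>. a \<beta> \<mu>)"
      using colim unfolding colimit_cocone_def by blast
    then have "cocone C {..<\<mu>} A a Z (\<lambda>\<beta>. g \<odot> a \<beta> \<mu>)"
      using cocone_postcompose[OF _ g] F(2) limit.IH by blast
    then have "\<exists>!k. k \<in> hom C (A \<mu>) Z \<and> (\<forall>\<beta>\<in>{..<\<mu>}. k \<odot> a \<beta> \<mu> = g \<odot> a \<beta> \<mu>)"
      using colim unfolding colimit_cocone_def by blast
    moreover have "\<forall>\<beta>\<in>{..<\<mu>}. h \<odot> a \<beta> \<mu> = g \<odot> a \<beta> \<mu>" using agree by simp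
    ultimately show "g = h" using g h by blast
  qed
qed

text \<open>
  A successor step solves the lifting problem of \<open>A\<^sub>\<beta> \<rightarrow> A\<^sub>\<beta>\<^sub>+\<^sub>1\<close> against \<open>g\<^sub>\<beta>\<^sub>+\<^sub>1\<close> along \<open>b\<close>,
  and a limit step uses that \<open>A\<^sub>\<mu>\<close> is a colimit.  The target is kept general because the
  lemma serves for two kinds of sequences over \<open>X\<close>: canonical predecompositions, and constant
  sequences at the domain of a morphism that is orthogonal to \<open>E\<close>.
\<close>

lemma comparison_morphism:
  assumes "ordinal \<gamma>" and seq: "E_transfinite_sequence C E \<gamma> A a"
    and epi: "\<And>p. p \<in> E \<Longrightarrow> epimorphism C p"
    and coc: "cocone C \<gamma> A a X f"
    and funB: "poset_functor C \<gamma> B b" and cocB: "cocone C \<gamma> B b X g"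
    and orth: "\<And>\<beta> \<beta>' p. \<beta> \<in> \<gamma> \<Longrightarrow> \<beta>' \<in> \<gamma> \<Longrightarrow> is_succ \<beta> \<beta>' \<Longrightarrow> p \<in> E \<Longrightarrow>
                 orthogonal_along C p (b \<beta> \<beta>') (g \<beta>')"
    and s: "s \<in> hom C (A ord_zero) (B ord_zero)" and gs: "g ord_zero \<odot> s = f ord_zero"
    and "\<alpha> \<in> \<gamma>"
  shows "\<exists>t \<in> hom C (A \<alpha>) (B \<alpha>). t \<odot> a ord_zero \<alpha> = b ord_zero \<alpha> \<odot> s \<and> g \<alpha> \<odot> t = f \<alpha>"
proof -
  note F = poset_functorD[OF E_transfinite_sequenceD(1)[OF seq]]
  note G = poset_functorD[OF funB]
  have z: "ord_zero \<in> \<gamma>"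
    using ordinal_downward[OF \<open>ordinal \<gamma>\<close> \<open>\<alpha> \<in> \<gamma>\<close>] ord_zero_le by blast
  note a0 = F(2)[OF z _ ord_zero_le] and b0 = G(2)[OF z _ ord_zero_le]
  have epi0: "epimorphism C (a ord_zero \<beta>)" if "\<beta> \<in> \<gamma>" for \<beta>
    using epimorphism_from_first_stage[OF \<open>ordinal \<gamma>\<close> seq epi that] by blast
  \<comment> \<open>Compatibility with the cocones and with the transition morphisms can be tested on the first
    stage, so the induction only has to produce morphisms with the right restriction.\<close>
  have leg: "g \<beta> \<odot> t = f \<beta>"
    if b: "\<beta> \<in> \<gamma>" and t: "t \<in> hom C (A \<beta>) (B \<beta>)" and r: "t \<odot> a ord_zero \<beta> = b ord_zero \<beta> \<odot> s"
    for \<beta> t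
  proof -
    note g = coconeD(2)[OF cocB b]
    have "g \<beta> \<odot> t \<odot> a ord_zero \<beta> = g \<beta> \<odot> (b ord_zero \<beta> \<odot> s)"
      using comp_assoc[OF a0[OF b] t g] r by simp
    also have "\<dots> = g \<beta> \<odot> b ord_zero \<beta> \<odot> s"
      using comp_assoc[OF s b0[OF b] g] by simp
    also have "\<dots> = f \<beta> \<odot> a ord_zero \<beta>"
      using coconeD(3)[OF cocB z b ord_zero_le] coconeD(3)[OF coc z b ord_zero_le] gs by simp
    finally show ?thesis
      using epimorphism_cancel[OF epi0[OF b] a0[OF b] comp_in_hom[OF t g] coconeD(2)[OF coc b]]
      by simp
  qed
  have natural: "t' \<odot> a \<beta> \<beta>' = b \<beta> \<beta>' \<odot> t"
    if b: "\<beta> \<in> \<gamma>" and b': "\<beta>' \<in> \<gamma>" and le: "\<beta> \<le> \<beta>'"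
      and t: "t \<in> hom C (A \<beta>) (B \<beta>)" and r: "t \<odot> a ord_zero \<beta> = b ord_zero \<beta> \<odot> s"
      and t': "t' \<in> hom C (A \<beta>') (B \<beta>')" and r': "t' \<odot> a ord_zero \<beta>' = b ord_zero \<beta>' \<odot> s"
    for \<beta> \<beta>' t t'
  proof -
    note a1 = F(2)[OF b b' le] and b1 = G(2)[OF b b' le]
    have "t' \<odot> a \<beta> \<beta>' \<odot> a ord_zero \<beta> = b ord_zero \<beta>' \<odot> s"
      using comp_assoc[OF a0[OF b] a1 t'] F(4)[OF z b b' ord_zero_le le] r' by simp
    also have "\<dots> = b \<beta> \<beta>' \<odot> t \<odot> a ord_zero \<beta>"
      using comp_assoc[OF a0[OF b] t b1] comp_assoc[OF s b0[OF b] b1]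
        G(4)[OF z b b' ord_zero_le le] r by simp
    finally show ?thesis
      using epimorphism_cancel[OF epi0[OF b] a0[OF b] comp_in_hom[OF a1 t'] comp_in_hom[OF t b1]]
      by simp
  qed
  have "\<exists>t \<in> hom C (A \<alpha>) (B \<alpha>). t \<odot> a ord_zero \<alpha> = b ord_zero \<alpha> \<odot> s"
    using \<open>ordinal \<gamma>\<close> \<open>\<alpha> \<in> \<gamma>\<close>
  proof (induction rule: ordinal_induct)
    case zero
    then show ?case
      using s comp_id_left[OF s] comp_id_right[OF s] F(3)[OF z] G(3)[OF z] by auto
  next
    case (succ \<beta> \<alpha>)
    then obtain t where t: "t \<in> hom C (A \<beta>) (B \<beta>)"
      and r: "t \<odot> a ord_zero \<beta> = b ord_zero \<beta> \<odot> s" by blast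
    note b = \<open>\<beta> \<in> \<gamma>\<close> and b' = \<open>\<alpha> \<in> \<gamma>\<close> and le = \<open>\<beta> \<le> \<alpha>\<close>
    note a1 = F(2)[OF b b' le] and b1 = G(2)[OF b b' le]
    have aE: "a \<beta> \<alpha> \<in> E" using E_transfinite_sequenceD(3)[OF seq] succ by blast
    have "g \<alpha> \<odot> b \<beta> \<alpha> \<odot> t = f \<alpha> \<odot> a \<beta> \<alpha>"
      using coconeD(3)[OF cocB b b' le] coconeD(3)[OF coc b b' le] leg[OF b t r] by simp
    then obtain h where h: "h \<in> hom C (A \<alpha>) (B \<alpha>)" and hr: "h \<odot> a \<beta> \<alpha> = b \<beta> \<alpha> \<odot> t"
      using orthogonal_alongE[OF orth[OF b b' \<open>is_succ \<beta> \<alpha>\<close> aE] a1 b1 coconeD(2)[OF cocB b'] t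
          coconeD(2)[OF coc b']] by metis
    have "h \<odot> a ord_zero \<alpha> = h \<odot> a \<beta> \<alpha> \<odot> a ord_zero \<beta>"
      using comp_assoc[OF a0[OF b] a1 h] F(4)[OF z b b' ord_zero_le le] by simp
    also have "\<dots> = b ord_zero \<alpha> \<odot> s"
      using hr comp_assoc[OF a0[OF b] t b1] comp_assoc[OF s b0[OF b] b1]
        G(4)[OF z b b' ord_zero_le le] r by simp
    finally show ?case using h by blast
  next
    case (limit \<mu>)
    then obtain t where t: "\<And>\<beta>. \<beta> < \<mu> \<Longrightarrow> t \<beta> \<in> hom C (A \<beta>) (B \<beta>)"
      and r: "\<And>\<beta>. \<beta> < \<mu> \<Longrightarrow> t \<beta> \<odot> a ord_zero \<beta> = b ord_zero \<beta> \<odot> s" by metis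
    have inG: "\<beta> \<in> \<gamma>" if "\<beta> < \<mu>" for \<beta> using limit.IH[OF that] by blast
    have b1: "b \<beta> \<mu> \<in> hom C (B \<beta>) (B \<mu>)" if "\<beta> < \<mu>" for \<beta>
      using G(2)[OF inG[OF that] \<open>\<mu> \<in> \<gamma>\<close>] that by simp
    have "cocone C {..<\<mu>} A a (B \<mu>) (\<lambda>\<beta>. b \<beta> \<mu> \<odot> t \<beta>)"
      unfolding cocone_def
    proof (intro conjI ballI impI)
      show "B \<mu> \<in> Ob C" using G(1) \<open>\<mu> \<in> \<gamma>\<close> by blast
    next
      fix \<beta> assume "\<beta> \<in> {..<\<mu>}"
      then show "b \<beta> \<mu> \<odot> t \<beta> \<in> hom C (A \<beta>) (B \<mu>)"
        using comp_in_hom t b1 by blast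
    next
      fix \<beta> \<beta>' assume "\<beta> \<in> {..<\<mu>}" "\<beta>' \<in> {..<\<mu>}" and le: "\<beta> \<le> \<beta>'"
      then have l: "\<beta> < \<mu>" "\<beta>' < \<mu>" by auto
      note a1 = F(2)[OF inG[OF l(1)] inG[OF l(2)] le]
        and b2 = G(2)[OF inG[OF l(1)] inG[OF l(2)] le]
      have "b \<beta>' \<mu> \<odot> t \<beta>' \<odot> a \<beta> \<beta>' = b \<beta>' \<mu> \<odot> (b \<beta> \<beta>' \<odot> t \<beta>)"
        using comp_assoc[OF a1 t[OF l(2)] b1[OF l(2)]]
          natural[OF inG[OF l(1)] inG[OF l(2)] le t[OF l(1)] r[OF l(1)] t[OF l(2)] r[OF l(2)]]
        by simp
      also have "\<dots> = b \<beta> \<mu> \<odot> t \<beta>"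
        using comp_assoc[OF t[OF l(1)] b2 b1[OF l(2)]]
          G(4)[OF inG[OF l(1)] inG[OF l(2)] \<open>\<mu> \<in> \<gamma>\<close> le less_imp_le[OF l(2)]] by simp
      finally show "b \<beta>' \<mu> \<odot> t \<beta>' \<odot> a \<beta> \<beta>' = b \<beta> \<mu> \<odot> t \<beta>" .
    qed
    then obtain h where h: "h \<in> hom C (A \<mu>) (B \<mu>)"
      and hr: "\<And>\<beta>. \<beta> \<in> {..<\<mu>} \<Longrightarrow> h \<odot> a \<beta> \<mu> = b \<beta> \<mu> \<odot> t \<beta>"
      using colimit_cocone_factor[OF E_transfinite_sequenceD(2)[OF seq \<open>\<mu> \<in> \<gamma>\<close> \<open>nonzero_limit \<mu>\<close>]]
      by blast
    have "t ord_zero = s"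
      using r[OF \<open>ord_zero < \<mu>\<close>] F(3)[OF z] G(3)[OF z] comp_id_left[OF s]
        comp_id_right[OF t[OF \<open>ord_zero < \<mu>\<close>]] by simp
    then show ?case using h hr[of ord_zero] \<open>ord_zero < \<mu>\<close> by auto
  qed
  then show ?thesis using leg[OF \<open>\<alpha> \<in> \<gamma>\<close>] by blast
qed

section \<open>Orthogonality of the canonical legs\<close>

lemma orthogonal_along_Id:
  assumes "m \<in> hom C A B"
  shows "orthogonal C p m \<longleftrightarrow> orthogonal_along C p (Id C A) m"
  using assms by (simp add: orthogonal_def hom_def)

text \<open>
  A lifting problem against \<open>n\<close> becomes one against \<open>m\<close> by composing with the section \<open>h\<close>, and
  its solution is sent back by the retraction \<open>t\<close>.
\<close>

lemma orthogonal_retract: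
  assumes p: "p \<in> Mor C"
    and m: "m \<in> hom C A X" and n: "n \<in> hom C B X"
    and t: "t \<in> hom C A B" and h: "h \<in> hom C B A"
    and th: "t \<odot> h = Id C B" and nt: "n \<odot> t = m"
    and orth: "orthogonal C p m"
  shows "orthogonal C p n"
proof -
  have A: "A \<in> Ob C" and B: "B \<in> Ob C"
    using m n dom_in_Ob by (auto simp: hom_def)
  have p': "p \<in> hom C (Dom C p) (Cod C p)" using p by (simp add: hom_def)
  have mh: "m \<odot> h = n"
    using comp_assoc[OF h t n] th nt comp_id_right[OF n] by simp
  have cod: "Cod C (Id C B) = B" "Dom C (Id C B) = B" "Cod C n = X"
    using id_in_hom[OF B] n by (simp_all add: hom_def)
  show ?thesis
    unfolding orthogonal_along_Id[OF n] unfolding orthogonal_along_def cod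
  proof (intro ballI impI)
    fix u v
    assume u: "u \<in> hom C (Dom C p) B" and v: "v \<in> hom C (Cod C p) X"
      and sq: "n \<odot> Id C B \<odot> u = v \<odot> p"
    have hu: "h \<odot> u \<in> hom C (Dom C p) A" using comp_in_hom[OF u h] .
    have "m \<odot> Id C A \<odot> (h \<odot> u) = v \<odot> p"
      using comp_id_right[OF m] comp_id_right[OF n] comp_assoc[OF u h m] mh sq by simp
    then obtain k where k: "k \<in> hom C (Cod C p) A" and kp: "k \<odot> p = Id C A \<odot> (h \<odot> u)"
      and mk: "m \<odot> k = v"
      and uniq: "\<And>k'. k' \<in> hom C (Cod C p) A \<Longrightarrow> k' \<odot> p = Id C A \<odot> (h \<odot> u) \<Longrightarrow>
                    m \<odot> k' = v \<Longrightarrow> k' = k"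
      using orthogonal_alongE[OF orth[unfolded orthogonal_along_Id[OF m]] p' id_in_hom[OF A] m hu v]
      by blast
    show "\<exists>!k. k \<in> hom C (Cod C p) B \<and> k \<odot> p = Id C B \<odot> u \<and> n \<odot> k = v"
    proof (rule ex1I[of _ "t \<odot> k"], intro conjI)
      show "t \<odot> k \<in> hom C (Cod C p) B" using comp_in_hom[OF k t] .
      show "t \<odot> k \<odot> p = Id C B \<odot> u"
        using comp_assoc[OF p' k t] kp comp_id_left[OF hu] comp_assoc[OF u h t] th by simp
      show "n \<odot> (t \<odot> k) = v" using comp_assoc[OF k t n] nt mk by simp
    next
      fix k' assume k': "k' \<in> hom C (Cod C p) B \<and> k' \<odot> p = Id C B \<odot> u \<and> n \<odot> k' = v"
      then have k'h: "k' \<in> hom C (Cod C p) B" by blast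
      have "h \<odot> k' = k"
      proof (rule uniq)
        show "h \<odot> k' \<in> hom C (Cod C p) A" using comp_in_hom[OF k'h h] .
        show "h \<odot> k' \<odot> p = Id C A \<odot> (h \<odot> u)"
          using comp_assoc[OF p' k'h h] k' comp_id_left[OF u] comp_id_left[OF hu] by simp
        show "m \<odot> (h \<odot> k') = v" using comp_assoc[OF k'h h m] mh k' by simp
      qed
      then show "k' = t \<odot> k"
        using comp_assoc[OF k'h h t] th comp_id_left[OF k'h] by simp
    qed
  qed
qed

lemma constant_poset_functor:
  assumes "A \<in> Ob C"
  shows "poset_functor C \<gamma> (\<lambda>_. A) (\<lambda>_ _. Id C A)"
  using assms id_in_hom comp_id_left unfolding poset_functor_def by blast

lemma constant_cocone:
  assumes "m \<in> hom C A X"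
  shows "cocone C \<gamma> (\<lambda>_. A) (\<lambda>_ _. Id C A) X (\<lambda>_. m)"
  using assms comp_id_right cod_in_Ob unfolding cocone_def by (auto simp: hom_def)

text \<open>
  The comparison \<open>t\<close> from \<open>D\<close> to \<open>K\<close> and the comparison \<open>h\<close> from \<open>K\<close> to the constant
  sequence at stage \<open>\<alpha>\<close> of \<open>D\<close> exhibit the leg of \<open>K\<close> as a retract of the leg of \<open>D\<close>.
\<close>

lemma canonical_leg_orthogonal:
  assumes E: "E \<subseteq> Mor C" and epi: "\<And>p. p \<in> E \<Longrightarrow> epimorphism C p"
    and K: "canonical_predecomposition C E \<gamma> K" "is_of K f"
    and D: "predecomposition C E \<gamma> D" "is_of D f"
    and \<alpha>: "\<alpha> \<in> \<gamma>" and orth: "\<And>p. p \<in> E \<Longrightarrow> orthogonal C p (Leg D \<alpha>)"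
    and p: "p \<in> E"
  shows "orthogonal C p (Leg K \<alpha>)"
proof -
  have K': "predecomposition C E \<gamma> K"
    using K(1) unfolding canonical_predecomposition_def by blast
  have X: "Apex D = Apex K" and A0: "Stage D ord_zero = Stage K ord_zero"
    using is_of_dom_cod[OF D] is_of_dom_cod[OF K' K(2)] by simp_all
  have f0: "Leg D ord_zero = f" "Leg K ord_zero = f"
    using D(2) K(2) by (simp_all add: is_of_def)
  note ord = predecompositionD(1)[OF D(1)]
  note seqD = predecompositionD(2)[OF D(1)] and seqK = predecompositionD(2)[OF K']
  note cocD = predecompositionD(3)[OF D(1), unfolded X] and cocK = predecompositionD(3)[OF K']
  note F = poset_functorD[OF E_transfinite_sequenceD(1)[OF seqD]]
  note G = poset_functorD[OF E_transfinite_sequenceD(1)[OF seqK]]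
  have z: "ord_zero \<in> \<gamma>" using ordinal_downward[OF ord \<alpha>] ord_zero_le by blast
  note a0 = F(2)[OF z \<alpha> ord_zero_le] and b0 = G(2)[OF z \<alpha> ord_zero_le]
  note fa = coconeD(2)[OF cocD \<alpha>] and ga = coconeD(2)[OF cocK \<alpha>]
  have s: "Id C (Stage K ord_zero) \<in> hom C (Stage D ord_zero) (Stage K ord_zero)"
    using id_in_hom[OF G(1)[OF z]] A0 by simp
  have gs: "Leg K ord_zero \<odot> Id C (Stage K ord_zero) = Leg D ord_zero"
    using comp_id_right[OF coconeD(2)[OF cocK z]] f0 by simp
  have "\<exists>t \<in> hom C (Stage D \<alpha>) (Stage K \<alpha>).
      t \<odot> Trans D ord_zero \<alpha> = Trans K ord_zero \<alpha> \<odot> Id C (Stage K ord_zero) \<and>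
      Leg K \<alpha> \<odot> t = Leg D \<alpha>"
    by (rule comparison_morphism[OF ord seqD epi cocD E_transfinite_sequenceD(1)[OF seqK] cocK _
          s gs \<alpha>])
      (use K(1) in \<open>auto simp: canonical_predecomposition_def\<close>)
  then obtain t where t: "t \<in> hom C (Stage D \<alpha>) (Stage K \<alpha>)"
    and ta: "t \<odot> Trans D ord_zero \<alpha> = Trans K ord_zero \<alpha>"
    and gt: "Leg K \<alpha> \<odot> t = Leg D \<alpha>"
    using comp_id_right[OF b0] by auto
  have s': "Trans D ord_zero \<alpha> \<in> hom C (Stage K ord_zero) (Stage D \<alpha>)" using a0 A0 by simp
  have gs': "Leg D \<alpha> \<odot> Trans D ord_zero \<alpha> = Leg K ord_zero"
    using coconeD(3)[OF cocD z \<alpha> ord_zero_le] f0 by simp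
  have "\<exists>h \<in> hom C (Stage K \<alpha>) (Stage D \<alpha>).
      h \<odot> Trans K ord_zero \<alpha> = Id C (Stage D \<alpha>) \<odot> Trans D ord_zero \<alpha> \<and>
      Leg D \<alpha> \<odot> h = Leg K \<alpha>"
    by (rule comparison_morphism[OF ord seqK epi cocK constant_poset_functor[OF F(1)[OF \<alpha>]]
          constant_cocone[OF fa] _ s' gs' \<alpha>])
      (use orth orthogonal_along_Id[OF fa] in auto)
  then obtain h where h: "h \<in> hom C (Stage K \<alpha>) (Stage D \<alpha>)"
    and hb: "h \<odot> Trans K ord_zero \<alpha> = Trans D ord_zero \<alpha>"
    using comp_id_left[OF a0] by auto
  have "t \<odot> h \<odot> Trans K ord_zero \<alpha> = Id C (Stage K \<alpha>) \<odot> Trans K ord_zero \<alpha>"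
    using comp_assoc[OF b0 h t] hb ta comp_id_left[OF b0] by simp
  then have "t \<odot> h = Id C (Stage K \<alpha>)"
    using epimorphism_cancel[OF epimorphism_from_first_stage[OF ord seqK epi \<alpha>] b0
        comp_in_hom[OF h t] id_in_hom[OF G(1)[OF \<alpha>]]] by simp
  then show ?thesis
    using orthogonal_retract[OF _ fa ga t h _ gt orth[OF p]] p E by blast
qed

lemma canonical_stabilizes_first:
  assumes "E \<subseteq> Mor C" and "\<And>p. p \<in> E \<Longrightarrow> epimorphism C p"
    and "canonical_predecomposition C E \<gamma> K" "is_of K f"
    and "predecomposition C E \<gamma> D" "is_of D f"
    and "stabilizes_at C E \<gamma> D \<alpha>"
  shows "stabilizes_at C E \<gamma> K \<alpha>"
  unfolding stabilizes_at_def
proof (intro conjI ballI impI)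
  show "\<alpha> \<in> \<gamma>" using assms(7) by (simp add: stabilizes_at_def)
next
  fix \<beta> p assume "\<beta> \<in> \<gamma>" "\<alpha> \<le> \<beta>" "p \<in> E"
  then show "orthogonal C p (Leg K \<beta>)"
    by (intro canonical_leg_orthogonal[OF assms(1-6), of \<beta> p])
      (use assms(7) in \<open>simp_all add: stabilizes_at_def\<close>)
qed

end


section \<open>Equality of the decomposition numbers\<close>

theorem theorem2p34:
  fixes C :: "('ob, 'mor) category" and E :: "'mor set" and f :: 'mor
  assumes "universe_ordinals TYPE('o::wellorder)"
    and "category C"
    and "E \<subseteq> Mor C"
    and "\<And>p. p \<in> E \<Longrightarrow> epimorphism C p"
    and "f \<in> Mor C"
    and "\<exists>D :: ('o, 'ob, 'mor) decomposition_data.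
           canonical_predecomposition C E UNIV D \<and> is_of D f"
  shows "((\<delta> C E f :: 'o option) \<noteq> None \<longleftrightarrow> (\<sigma> C E f :: 'o option) \<noteq> None) \<and>
         ((\<delta> C E f :: 'o option) \<noteq> None \<longrightarrow> (\<sigma> C E f :: 'o option) \<noteq> None \<longrightarrow>
            (\<delta> C E f :: 'o option) = \<sigma> C E f)"
proof -
  interpret category C by fact
  let ?dec = "\<lambda>D :: ('o, 'ob, 'mor) decomposition_data. decomposition C E UNIV D \<and> is_of D f"
  let ?can = "\<lambda>D :: ('o, 'ob, 'mor) decomposition_data.
                canonical_predecomposition C E UNIV D \<and> is_of D f"
  let ?len = "\<lambda>D :: ('o, 'ob, 'mor) decomposition_data. decomposition_length C E UNIV D"
  have transfer: "stabilizes_at C E UNIV K \<alpha>"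
    if "?can K" "?dec D" "stabilizes_at C E UNIV D \<alpha>" for K D and \<alpha> :: 'o
    using canonical_stabilizes_first[OF assms(3,4), of UNIV K f D \<alpha>] that
    unfolding decomposition_def by blast
  have can_dec: "?dec K" if K: "?can K" and D: "?dec D" for K D
    using transfer[OF K D] D K
    unfolding decomposition_def canonical_predecomposition_def by blast
  have shorter: "?len K \<le> ?len D" if K: "?can K" and D: "?dec D" for K D
  proof -
    have "\<exists>\<alpha>. stabilizes_at C E UNIV D \<alpha>" using D unfolding decomposition_def by blast
    then have "stabilizes_at C E UNIV D (?len D)"
      unfolding decomposition_length_def by (rule LeastI_ex)
    from transfer[OF K D this] show ?thesis
      unfolding decomposition_length_def[of C E UNIV K] by (rule Least_le)
  qed
  obtain K where K: "?can K" using assms(6) by blast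
  show ?thesis
  proof (cases "\<exists>D. ?dec D")
    case True
    then have Kd: "?dec K" using can_dec[OF K] by blast
    have "\<delta> C E f = Some (?len K)"
      unfolding min_decomposition_number_def using True Kd shorter[OF K]
      by (auto intro!: Least_equality)
    moreover have "\<sigma> C E f = Some (?len K)"
    proof -
      have "(THE \<alpha>. \<exists>D. canonical_predecomposition C E UNIV D \<and> is_of D f \<and>
               decomposition C E UNIV D \<and> ?len D = \<alpha>) = ?len K"
      proof (rule the_equality)
        show "\<exists>D. canonical_predecomposition C E UNIV D \<and> is_of D f \<and>
               decomposition C E UNIV D \<and> ?len D = ?len K"
          using K Kd by blast
      next
        fix \<alpha> :: 'o
        assume "\<exists>D. canonical_predecomposition C E UNIV D \<and> is_of D f \<and>
                 decomposition C E UNIV D \<and> ?len D = \<alpha>"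
        then obtain D where "?can D" "?dec D" "?len D = \<alpha>" by blast
        \<comment> \<open>Two canonical decompositions bound each other's length.\<close>
        then show "\<alpha> = ?len K" using shorter[of D K] shorter[of K D] K Kd by force
      qed
      then show ?thesis
        unfolding canonical_decomposition_number_def using K Kd by auto
    qed
    ultimately show ?thesis by simp
  next
    case False
    then show ?thesis
      unfolding min_decomposition_number_def canonical_decomposition_number_def by auto
  qed
qed

end
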